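(* Let $d\ge 1$ and let $\Gamma_d\in[0,\infty]$ be the value of the response-history escape game in dimension $d$. Consider the system $$x_{t+1}=f(x_t)+u_t+w_{t+1},\qquad x_t,u_t,w_t\in\mathbb{R}^d,\ t\ge 0.$$ The following hold. (a) (Subcritical stabilization.) There exists a single causal feedback law $\Sigma^*$ such that, for every $0\le L<\Gamma_d$, every initial state $x_0\in\mathbb{R}^d$, every plant $f\in\mathcal F_d(L)$, and every bounded disturbance sequence $(w_t)_{t\ge1}$ in $\mathbb{R}^d$, the closed-loop state sequence is bounded, i.e. $\sup_{t\ge0}\|x_t\|<\infty$. (b) (Supercritical impossibility.) If $L>\Gamma_d$, then for every causal feedback law $\Sigma$ and every initial state $x_0\in\mathbb{R}^d$, there exist $f\colon\mathbb{R}^d\to\mathbb{R}^d$ with $\|f\|_{\mathrm{gL},d}<L$ and a bounded disturbance sequence $(w_t)_{t\ge1}$ in $\mathbb{R}^d$ such that the closed-loop state sequence from $x_0$ under $\Sigma$ is unbounded.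
   Context: $\|\cdot\|$ is the Euclidean norm on $\mathbb{R}^d$. Plant problem. A causal feedback law is a sequence $\Sigma=(\Sigma_t)_{t\ge0}$ of arbitrary maps (no measurability or continuity required) $\Sigma_t\colon(\mathbb{R}^d)^{t+1}\times(\mathbb{R}^d)^t\to\mathbb{R}^d$, applied as $u_t=\Sigma_t(x_0,\dots,x_t;u_0,\dots,u_{t-1})$. Given $x_0$, $f$, $(w_t)_{t\ge1}$ and $\Sigma$, the equation $x_{t+1}=f(x_t)+u_t+w_{t+1}$ determines the closed-loop state sequence recursively. A disturbance sequence is bounded if $\sup_{t\ge1}\|w_t\|<\infty$. For $f\colon\mathbb{R}^d\to\mathbb{R}^d$, $$\|f\|_{\mathrm{gL},d}=\lim_{\alpha\to\infty}\ \sup_{x,y\in\mathbb{R}^d}\frac{\|f(x)-f(y)\|}{\|x-y\|+\alpha}\in[0,\infty],$$ and $\mathcal F_d(L)=\{f\colon\mathbb{R}^d\to\mathbb{R}^d\mid \|f\|_{\mathrm{gL},d}\le L\}$ for $L\ge0$. Escape game. A finite response history of length $n\ge0$ is $H=(x_0,\dots,x_n;r_0,\dots,r_{n-1})$ with all $x_i,r_i\in\mathbb{R}^d$ (no responses if $n=0$). Its state radius is $\operatorname{rad}(H)=\max_{0\le i\le n}\|x_i-x_0\|$. For $u,r\in\mathbb{R}^d$ the successor history is $H^+(u,r)=(x_0,\dots,x_n,u+r;r_0,\dots,r_{n-1},r)$. For $\ell\ge0$, $\operatorname{Env}_\ell(H)=0$ if $n=0$, and $\operatorname{Env}_\ell(H)=\max_{0\le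 i,j\le n-1}(\|r_i-r_j\|-\ell\|x_i-x_j\|)_+$ if $n\ge1$, where $q_+=\max\{q,0\}$. A play from an initial history $H^0$ is a sequence $\pi=(H^k,u_k,r_k,H^{k+1})_{k\ge0}$ with $u_k,r_k\in\mathbb{R}^d$ and $H^{k+1}=(H^k)^+(u_k,r_k)$. At stage $k$ the controller sees $H^k$ and chooses $u_k$; then the adversary sees $(H^k,u_k)$ and chooses $r_k$. A controller strategy is an arbitrary map $\mu$ from finite response histories to $\mathbb{R}^d$ ($u_k=\mu(H^k)$); an adversary strategy is an arbitrary map $\sigma$ from pairs $(H,u)$ to $\mathbb{R}^d$ ($r_k=\sigma(H^k,u_k)$). Let $\operatorname{Env}^\infty_\ell(\pi)=\sup_k\operatorname{Env}_\ell(H^k)$, and let $\operatorname{Esc}_{\ell,H^0}$ be the set of plays $\pi$ from $H^0$ with $\operatorname{Env}^\infty_\ell(\pi)<\infty$ and $\sup_k\operatorname{rad}(H^k)=\infty$. The adversary wins from $H^0$ for $\operatorname{Esc}_{\ell,H^0}$ if there is an adversary strategy $\sigma$ such that for every controller strategy $\mu$ the resulting play lies in $\operatorname{Esc}_{\ell,H^0}$. Let $\mathcal U_\ell$ be the set of finite response histories $H$ from which the adversary wins for $\operatorname{Esc}_{\ell,H}$. The game value is $$\Gamma_d=\sup\bigl(\{0\}\cup\{\ell\ge0\mid\mathcal U_\ell=\varnothing\}\bigr)\in[0,\infty].$$ *)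

theory Defs
  imports "HOL-Analysis.Analysis"
begin

text \<open>The supremum is nonincreasing in \<open>\<alpha> > 0\<close>, so the limit exists in the extended reals;
  see \<open>gL_norm_tendsto\<close> below.\<close>

definition gL_quot :: "('a::euclidean_space \<Rightarrow> 'a) \<Rightarrow> real \<Rightarrow> ereal" where
  "gL_quot f \<alpha> = (SUP (x, y) \<in> UNIV. ereal (norm (f x - f y) / (norm (x - y) + \<alpha>)))"

definition gL_norm :: "('a::euclidean_space \<Rightarrow> 'a) \<Rightarrow> ereal" where
  "gL_norm f = Lim at_top (gL_quot f)"

definition plants :: "real \<Rightarrow> ('a::euclidean_space \<Rightarrow> 'a) set" where
  "plants L = {f. gL_norm f \<le> ereal L}"

text \<open>A causal feedback law \<open>S\<close> is applied as
  \<open>u\<^sub>t = S t [x\<^sub>0, \<dots>, x\<^sub>t] [u\<^sub>0, \<dots>, u\<^bsub>t-1\<^esub>]\<close>; its values on lists of other lengths are never used.\<close>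

type_synonym 'a feedback = "nat \<Rightarrow> 'a list \<Rightarrow> 'a list \<Rightarrow> 'a"

text \<open>\<open>closed_loop f S w x0 t\<close> is the pair of lists
  \<open>([x\<^sub>0, \<dots>, x\<^sub>t], [u\<^sub>0, \<dots>, u\<^bsub>t-1\<^esub>])\<close>. The value \<open>w 0\<close> is never used.\<close>

primrec closed_loop ::
  "('a::euclidean_space \<Rightarrow> 'a) \<Rightarrow> 'a feedback \<Rightarrow> (nat \<Rightarrow> 'a) \<Rightarrow> 'a \<Rightarrow> nat \<Rightarrow> 'a list \<times> 'a list"
where
  "closed_loop f S w x0 0 = ([x0], [])"
| "closed_loop f S w x0 (Suc t) =
    (let (xs, us) = closed_loop f S w x0 t; u = S t xs us
     in (xs @ [f (last xs) + u + w (Suc t)], us @ [u]))"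

definition closed_loop_state ::
  "('a::euclidean_space \<Rightarrow> 'a) \<Rightarrow> 'a feedback \<Rightarrow> (nat \<Rightarrow> 'a) \<Rightarrow> 'a \<Rightarrow> nat \<Rightarrow> 'a"
where
  "closed_loop_state f S w x0 t = last (fst (closed_loop f S w x0 t))"

definition closed_loop_input ::
  "('a::euclidean_space \<Rightarrow> 'a) \<Rightarrow> 'a feedback \<Rightarrow> (nat \<Rightarrow> 'a) \<Rightarrow> 'a \<Rightarrow> nat \<Rightarrow> 'a"
where
  "closed_loop_input f S w x0 t = (case closed_loop f S w x0 t of (xs, us) \<Rightarrow> S t xs us)"

text \<open>\<open>(xs, rs)\<close> encodes \<open>(x\<^sub>0, \<dots>, x\<^sub>n; r\<^sub>0, \<dots>, r\<^bsub>n-1\<^esub>)\<close>, where \<open>n = length rs\<close>. Strategies are total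
  functions on all pairs of lists, but in a play that starts from a history they are only ever
  applied to histories.\<close>

type_synonym 'a history = "'a list \<times> 'a list"

definition is_history :: "'a history \<Rightarrow> bool" where
  "is_history H \<longleftrightarrow> length (fst H) = length (snd H) + 1"

definition rad :: "'a::euclidean_space history \<Rightarrow> real" where
  "rad = (\<lambda>(xs, rs). MAX i\<in>{0..length rs}. norm (xs ! i - xs ! 0))"

definition successor :: "'a::euclidean_space history \<Rightarrow> 'a \<Rightarrow> 'a \<Rightarrow> 'a history" where
  "successor = (\<lambda>(xs, rs) u r. (xs @ [u + r], rs @ [r]))"

definition Env :: "real \<Rightarrow> 'a::euclidean_space history \<Rightarrow> real" where
  "Env l = (\<lambda>(xs, rs). if rs = [] then 0 else
     (MAX (i, j)\<in>{..<length rs} \<times> {..<length rs}.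
        max (norm (rs ! i - rs ! j) - l * norm (xs ! i - xs ! j)) 0))"

type_synonym 'a play = "nat \<Rightarrow> 'a history \<times> 'a \<times> 'a \<times> 'a history"

definition play_hist :: "'a play \<Rightarrow> nat \<Rightarrow> 'a history" where
  "play_hist p k = fst (p k)"

definition is_play :: "'a::euclidean_space history \<Rightarrow> 'a play \<Rightarrow> bool" where
  "is_play H0 p \<longleftrightarrow> play_hist p 0 = H0 \<and>
     (\<forall>k. case p k of (H, u, r, H') \<Rightarrow> H' = successor H u r \<and> play_hist p (Suc k) = H')"

definition Env_inf :: "real \<Rightarrow> 'a::euclidean_space play \<Rightarrow> ereal" where
  "Env_inf l p = (SUP k. ereal (Env l (play_hist p k)))"

definition Esc :: "real \<Rightarrow> 'a::euclidean_space history \<Rightarrow> 'a play set" where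
  "Esc l H0 = {p. is_play H0 p \<and> Env_inf l p < \<infinity> \<and> (SUP k. ereal (rad (play_hist p k))) = \<infinity>}"

type_synonym 'a controller = "'a history \<Rightarrow> 'a"
type_synonym 'a adversary = "'a history \<Rightarrow> 'a \<Rightarrow> 'a"

primrec hist_seq ::
  "'a::euclidean_space history \<Rightarrow> 'a controller \<Rightarrow> 'a adversary \<Rightarrow> nat \<Rightarrow> 'a history"
where
  "hist_seq H0 \<mu> \<sigma> 0 = H0"
| "hist_seq H0 \<mu> \<sigma> (Suc k) =
    (let H = hist_seq H0 \<mu> \<sigma> k; u = \<mu> H in successor H u (\<sigma> H u))"

definition resulting_play ::
  "'a::euclidean_space history \<Rightarrow> 'a controller \<Rightarrow> 'a adversary \<Rightarrow> 'a play"
where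
  "resulting_play H0 \<mu> \<sigma> k =
    (let H = hist_seq H0 \<mu> \<sigma> k; u = \<mu> H; r = \<sigma> H u in (H, u, r, successor H u r))"

definition adversary_wins :: "real \<Rightarrow> 'a::euclidean_space history \<Rightarrow> bool" where
  "adversary_wins l H0 \<longleftrightarrow> (\<exists>\<sigma>. \<forall>\<mu>. resulting_play H0 \<mu> \<sigma> \<in> Esc l H0)"

definition winning_histories :: "real \<Rightarrow> 'a::euclidean_space history set" where
  "winning_histories l = {H. is_history H \<and> adversary_wins l H}"

definition game_value :: "'a::euclidean_space itself \<Rightarrow> ereal" where
  "game_value _ =
    Sup ({0} \<union> {ereal l |l. 0 \<le> l \<and> (winning_histories l :: 'a history set) = {}})"

lemma gL_quot_antimono:
  assumes "0 < \<alpha>" "\<alpha> \<le> \<beta>"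
  shows "gL_quot f \<beta> \<le> gL_quot f \<alpha>"
  unfolding gL_quot_def
proof (rule SUP_mono, clarify)
  fix x y :: 'a
  have "norm (f x - f y) / (norm (x - y) + \<beta>) \<le> norm (f x - f y) / (norm (x - y) + \<alpha>)"
    using assms by (intro divide_left_mono) (auto intro!: mult_pos_pos add_nonneg_pos)
  then show "\<exists>q\<in>UNIV. ereal (norm (f x - f y) / (norm (x - y) + \<beta>))
      \<le> (case q of (x, y) \<Rightarrow> ereal (norm (f x - f y) / (norm (x - y) + \<alpha>)))"
    by (intro bexI[of _ "(x, y)"]) auto
qed

lemma gL_norm_tendsto: "(gL_quot f \<longlongrightarrow> gL_norm f) at_top"
proof -
  let ?l = "INF \<alpha>\<in>{0<..}. gL_quot f \<alpha>"
  have "(gL_quot f \<longlongrightarrow> ?l) at_top"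
  proof (rule order_tendstoI)
    fix a assume "a < ?l"
    then have "a < gL_quot f \<alpha>" if "\<alpha> > 0" for \<alpha>
      using that by (auto intro: less_le_trans INF_lower)
    then show "\<forall>\<^sub>F \<alpha> in at_top. a < gL_quot f \<alpha>"
      by (intro eventually_mono[OF eventually_gt_at_top[of 0]])
  next
    fix a assume "?l < a"
    then obtain \<alpha> where "\<alpha> > 0" "gL_quot f \<alpha> < a"
      by (auto simp: INF_less_iff)
    then show "\<forall>\<^sub>F \<beta> in at_top. gL_quot f \<beta> < a"
      by (intro eventually_mono[OF eventually_ge_at_top[of \<alpha>]])
        (auto intro: le_less_trans[OF gL_quot_antimono])
  qed
  then show ?thesis
    unfolding gL_norm_def by (metis tendsto_Lim trivial_limit_at_top_linorder)
qed

lemma closed_loop_eq: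
  "closed_loop f S w x0 t =
    (map (closed_loop_state f S w x0) [0..<Suc t], map (closed_loop_input f S w x0) [0..<t])"
proof (induction t)
  case 0
  show ?case by (simp add: closed_loop_state_def)
next
  case (Suc t)
  have "closed_loop_state f S w x0 (Suc t) =
      last (fst (closed_loop f S w x0 (Suc t)))"
    by (rule closed_loop_state_def)
  moreover have "closed_loop_input f S w x0 t =
      S t (fst (closed_loop f S w x0 t)) (snd (closed_loop f S w x0 t))"
    by (simp add: closed_loop_input_def case_prod_beta)
  ultimately show ?case
    using Suc by (simp add: Let_def)
qed

lemma closed_loop_recursion:
  "closed_loop_state f S w x0 0 = x0"
  "closed_loop_input f S w x0 t =
     S t (map (closed_loop_state f S w x0) [0..<Suc t]) (map (closed_loop_input f S w x0) [0..<t])"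
  "closed_loop_state f S w x0 (Suc t) =
     f (closed_loop_state f S w x0 t) + closed_loop_input f S w x0 t + w (Suc t)"
proof -
  show "closed_loop_state f S w x0 0 = x0"
    by (simp add: closed_loop_state_def)
  show *: "closed_loop_input f S w x0 t =
     S t (map (closed_loop_state f S w x0) [0..<Suc t]) (map (closed_loop_input f S w x0) [0..<t])"
    by (subst closed_loop_input_def) (simp add: closed_loop_eq)
  show "closed_loop_state f S w x0 (Suc t) =
     f (closed_loop_state f S w x0 t) + closed_loop_input f S w x0 t + w (Suc t)"
    by (subst closed_loop_state_def) (simp add: closed_loop_eq[of f S w x0 t] * Let_def)
qed

lemma is_history_hist_seq: "is_history H0 \<Longrightarrow> is_history (hist_seq H0 \<mu> \<sigma> k)"
  by (induction k) (auto simp: is_history_def successor_def Let_def case_prod_beta)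

lemma is_play_resulting_play: "is_play H0 (resulting_play H0 \<mu> \<sigma>)"
  by (simp add: is_play_def play_hist_def resulting_play_def Let_def)

end

(*
  (a) Bound the envelope by M. The adversary's remaining aim, an unbounded radius, is a
  Buechi-type condition, and such games are determined with strategies that depend only on
  the current history, on both sides. If the adversary wins the escape game at level l from
  no history, the controller therefore has for each M a strategy that keeps the radius
  bounded as long as the envelope stays below M. Run through all pairs (l, M), with l in a
  sequence of such levels that increases to the game value, and move on to the next pair
  whenever the current one is refuted. For a plant with gL-norm below the game value only
  finitely many pairs are refuted.

  (b) For L above the game value, the adversary wins at some level l < L from some history.
  Play its strategy against the feedback law. The responses are l-Lipschitz in the states up
  to an additive constant, so by Kirszbraun's theorem a Lipschitz map f with constant below
  L reproduces them up to a bounded error, and that error is the disturbance.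
*)
theory Submission
  imports Defs
begin

section \<open>Stages of a least fixed point\<close>

text \<open>\<open>st x\<close> is the largest stage of the transfinite iteration of \<open>F\<close> that does not contain
  \<open>x\<close>, so comparing \<open>st x\<close> and \<open>st y\<close> compares ordinal ranks without mentioning ordinals.\<close>

lemma lfp_stages:
  fixes F :: "'a set \<Rightarrow> 'a set"
  assumes "mono F"
  obtains st where
    "wf {(x, y). st x \<subset> st y}"
    "\<And>x. st x \<subseteq> lfp F"
    "\<And>x. x \<in> lfp F \<Longrightarrow> x \<in> F (st x)"
    "\<And>x y. y \<in> st x \<Longrightarrow> st y \<subset> st x"
    "\<And>x y. y \<in> F (st x) \<Longrightarrow> y \<notin> st x \<Longrightarrow> st y = st x"
proof -
  \<comment> \<open>The least family of sets closed under \<open>F\<close> and arbitrary unions,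
    written as the intersection of all such families. The empty union makes the empty set a
    stage.\<close>
  define stage where "stage X \<longleftrightarrow>
      (\<forall>P. (\<forall>Y. P Y \<longrightarrow> P (F Y)) \<and> (\<forall>\<Y>. (\<forall>Y\<in>\<Y>. P Y) \<longrightarrow> P (\<Union>\<Y>)) \<longrightarrow> P X)" for X
  have stage_F: "stage (F X)" if "stage X" for X
    using that unfolding stage_def by blast
  have stage_Union: "stage (\<Union>\<X>)" if "\<And>X. X \<in> \<X> \<Longrightarrow> stage X" for \<X>
    unfolding stage_def
  proof (intro allI impI)
    fix P assume P: "(\<forall>Y. P Y \<longrightarrow> P (F Y)) \<and> (\<forall>\<Y>. (\<forall>Y\<in>\<Y>. P Y) \<longrightarrow> P (\<Union>\<Y>))"
    have "P X" if "X \<in> \<X>" for X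
      using \<open>X \<in> \<X> \<Longrightarrow> stage X\<close>[OF that] P unfolding stage_def by blast
    then show "P (\<Union>\<X>)" using P by blast
  qed
  have stage_induct [consumes 1, case_names step Union]: "Q X" if "stage X" and
      step: "\<And>X. stage X \<Longrightarrow> Q X \<Longrightarrow> Q (F X)" and
      union: "\<And>\<X>. (\<And>X. X \<in> \<X> \<Longrightarrow> stage X) \<Longrightarrow> (\<And>X. X \<in> \<X> \<Longrightarrow> Q X) \<Longrightarrow> Q (\<Union>\<X>)" for Q X
  proof -
    have "stage X \<and> Q X"
    proof (rule \<open>stage X\<close>[unfolded stage_def, rule_format, of "\<lambda>X. stage X \<and> Q X"], intro conjI allI impI)
      fix Y assume "stage Y \<and> Q Y"
      then show "stage (F Y)" "Q (F Y)" using stage_F step by auto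
    next
      fix \<Y> assume "\<forall>Y\<in>\<Y>. stage Y \<and> Q Y"
      then show "stage (\<Union>\<Y>)" "Q (\<Union>\<Y>)" using stage_Union union by auto
    qed
    then show ?thesis ..
  qed
  have F_mono: "F X \<subseteq> F Y" if "X \<subseteq> Y" for X Y
    using monoD[OF assms that] .
  have infl: "X \<subseteq> F X" if "stage X" for X
    using that
  proof (induction rule: stage_induct)
    case (step X) then show ?case by (intro F_mono)
  next
    case (Union \<X>) then show ?case using F_mono[OF Union_upper[of _ \<X>]] by blast
  qed
  txt \<open>That stages form a chain is the Bourbaki--Witt argument: extreme stages are comparable to
    every stage, and all stages are extreme.\<close>
  define extreme where "extreme X \<longleftrightarrow> (\<forall>Y. stage Y \<longrightarrow> Y \<subset> X \<longrightarrow> F Y \<subseteq> X)" for X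
  have comparable: "Y \<subseteq> X \<or> F X \<subseteq> Y" if "extreme X" "stage Y" for X Y
    using that(2)
  proof (induction rule: stage_induct)
    case (step Y)
    then consider "Y \<subset> X" | "Y = X" | "F X \<subseteq> Y" by blast
    then show ?case
    proof cases
      case 1 then show ?thesis using \<open>extreme X\<close> \<open>stage Y\<close> by (simp add: extreme_def)
    next
      case 3 then show ?thesis using infl[OF \<open>stage Y\<close>] by blast
    qed simp
  next
    case (Union \<Y>) then show ?case by blast
  qed
  have extreme: "extreme X" if "stage X" for X
    using that
  proof (induction rule: stage_induct)
    case (step X)
    show ?case unfolding extreme_def
    proof (intro allI impI)
      fix Y assume "stage Y" "Y \<subset> F X"
      then have "Y \<subseteq> X" using comparable[OF \<open>extreme X\<close> \<open>stage Y\<close>] by blast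
      then show "F Y \<subseteq> F X" by (rule F_mono)
    qed
  next
    case (Union \<X>)
    show ?case unfolding extreme_def
    proof (intro allI impI)
      fix Y assume "stage Y" "Y \<subset> \<Union>\<X>"
      then obtain X where X: "X \<in> \<X>" "\<not> X \<subseteq> Y" by blast
      then have "Y \<subset> X" using comparable[OF Union(2)[OF X(1)] \<open>stage Y\<close>] infl[OF Union(1)[OF X(1)]] by blast
      then have "F Y \<subseteq> X" using Union(2)[OF X(1)] \<open>stage Y\<close> by (simp add: extreme_def)
      then show "F Y \<subseteq> \<Union>\<X>" using X(1) by blast
    qed
  qed
  have dich: "Y \<subseteq> X \<or> F X \<subseteq> Y" if "stage X" "stage Y" for X Y
    using comparable[OF extreme] that by blast
  have sub_lfp: "X \<subseteq> lfp F" if "stage X" for X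
    using that
  proof (induction rule: stage_induct)
    case (step X) then show ?case using F_mono[of X "lfp F"] lfp_unfold[OF assms] by blast
  qed blast

  define st where "st x = \<Union>{X. stage X \<and> x \<notin> X}" for x
  have st: "stage (st x)" "x \<notin> st x" for x
    unfolding st_def by (auto intro: stage_Union)
  have st_max: "X \<subseteq> st x" if "stage X" "x \<notin> X" for X x
    unfolding st_def using that by blast
  have st_eq: "st y = X" if "stage X" "y \<in> F X" "y \<notin> X" for X y
    using dich[OF that(1) st(1)[of y]] st(2)[of y] st_max[OF that(1,3)] that by blast
  have fix_st: "lfp F \<subseteq> X" if "stage X" "F X \<subseteq> X" for X
    using that by (intro lfp_lowerbound)
  have in_F_st: "x \<in> F (st x)" if "x \<in> lfp F" for x
  proof (rule ccontr)
    assume "x \<notin> F (st x)"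
    then have "F (st x) \<subseteq> st x" using st_max stage_F st(1) by blast
    then show False using fix_st st that by blast
  qed
  show thesis
  proof
    show "wf {(x, y). st x \<subset> st y}"
    proof (rule wfI_min)
      fix q :: 'a and Q assume "q \<in> Q"
      \<comment> \<open>The largest stage disjoint from \<open>Q\<close>. If \<open>F S\<close>
        meets \<open>Q\<close>, the new elements have \<open>st\<close> equal to \<open>S\<close>;
        otherwise \<open>S\<close> is already \<open>lfp F\<close>, and all of \<open>Q\<close> has
        \<open>st\<close> equal to \<open>S\<close>.\<close>
      define S where "S = \<Union>{X. stage X \<and> X \<inter> Q = {}}"
      have S: "stage S" "S \<inter> Q = {}"
        unfolding S_def by (auto intro: stage_Union)
      have "\<exists>z\<in>Q. st z = S"
      proof (cases "F S \<inter> Q = {}")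
        case True
        then have "F S \<subseteq> S" using stage_F[OF S(1)] unfolding S_def by blast
        then have "st q \<subseteq> S" using fix_st[OF S(1)] sub_lfp[OF st(1)] by blast
        then show ?thesis using \<open>q \<in> Q\<close> st_max[OF S(1)] S(2) by blast
      next
        case False
        then show ?thesis using st_eq[OF S(1)] S(2) by blast
      qed
      then obtain z where z: "z \<in> Q" "st z = S" ..
      have "y \<notin> Q" if "st y \<subset> st z" for y
        using that z S st_max[OF S(1), of y] by blast
      then show "\<exists>z\<in>Q. \<forall>y. (y, z) \<in> {(x, y). st x \<subset> st y} \<longrightarrow> y \<notin> Q"
        using z(1) by blast
    qed
    show "st x \<subseteq> lfp F" for x by (rule sub_lfp[OF st(1)])
    show "x \<in> lfp F \<Longrightarrow> x \<in> F (st x)" for x by (rule in_F_st)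
    show "st y = st x" if "y \<in> F (st x)" "y \<notin> st x" for x y
      by (rule st_eq[OF st(1) that])
    \<comment> \<open>Stages are nested, and \<open>y\<close> lies in \<open>st x\<close> but not in
      \<open>st y\<close>.\<close>
    show "st y \<subset> st x" if "y \<in> st x" for x y
      using dich[OF st(1) st(1), of y x] in_F_st[of y] st(2)[of y] sub_lfp[OF st(1), of x]
        st(2)[of x] infl[OF st(1), of y] dich[OF st(1) st(1), of x y] that  by blast
  qed
qed

section \<open>Determinacy of pursuit games\<close>

lemma bounded_incseq_nat_eventually_const:
  fixes f :: "nat \<Rightarrow> nat"
  assumes "incseq f" "\<And>k. f k \<le> N"
  shows "\<exists>k0. \<forall>k\<ge>k0. f k = f k0"
proof -
  have fin: "finite (range f)" using assms(2) by (intro finite_subset[OF _ finite_atMost[of N]]) auto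
  obtain k0 where k0: "Max (range f) = f k0" using Max_in[OF fin] by auto
  have "f k = f k0" if "k0 \<le> k" for k
    using Max_ge[OF fin, of "f k"] k0 incseqD[OF assms(1) that] by simp
  then show ?thesis by blast
qed

text \<open>The controller picks \<open>u\<close>, then the adversary picks \<open>r\<close>, aiming
  at a play that is safe forever and of unbounded height. The axioms make unsafety irrevocable and
  the height monotone along safe moves.\<close>

locale pursuit_game =
  fixes step :: "'p \<Rightarrow> 'u \<Rightarrow> 'r \<Rightarrow> 'p" and safe :: "'p \<Rightarrow> bool" and h :: "'p \<Rightarrow> real"
  assumes safe_step: "safe (step p u r) \<Longrightarrow> safe p"
    and h_step: "safe (step p u r) \<Longrightarrow> h p \<le> h (step p u r)"
begin

definition pre :: "'p set \<Rightarrow> 'p set \<Rightarrow> 'p set" where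
  "pre T X = T \<union> {p. \<forall>u. \<exists>r. step p u r \<in> X}"

text \<open>The adversary's attractor: the positions from which it can force a visit to
  \<open>T\<close>.\<close>

definition attr :: "'p set \<Rightarrow> 'p set" where
  "attr T = lfp (pre T)"

definition high :: "nat \<Rightarrow> 'p set" where
  "high N = {p. safe p \<and> real N \<le> h p}"

text \<open>\<open>evade X\<close> collects the positions from which, for some \<open>N\<close>, the controller keeps the height
  below \<open>N\<close> until the play becomes unsafe or enters \<open>X\<close>.\<close>

definition evade :: "'p set \<Rightarrow> 'p set" where
  "evade X = {p. \<exists>N. p \<notin> attr (high N - X)}"

text \<open>Iterating \<open>evade\<close> lets the controller give up a bound finitely often, each
  time on reaching a position of smaller rank.\<close>

definition bounded_region :: "'p set" where
  "bounded_region = lfp evade"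

lemma mono_pre: "mono (pre T)"
  by (rule monoI) (auto simp: pre_def, blast)

lemma attr_unfold: "attr T = pre T (attr T)"
  unfolding attr_def by (rule lfp_unfold[OF mono_pre])

lemma attr_least: "T \<subseteq> attr T' \<Longrightarrow> attr T \<subseteq> attr T'"
  unfolding attr_def[of T] using attr_unfold[of T'] by (intro lfp_lowerbound) (auto simp: pre_def)

lemma attr_superset: "T \<subseteq> attr T"
  by (subst attr_unfold) (auto simp: pre_def)

text \<open>\<open>safe_step\<close> carries safety backwards along moves. This keeps an adversary
  safe that never leaves attractors.\<close>

lemma attr_high_safe: "attr (high N - X) \<subseteq> {p. safe p}"
  unfolding attr_def by (rule lfp_lowerbound) (auto simp: pre_def high_def intro: safe_step)

lemma mono_evade: "mono evade"
proof (rule monoI)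
  fix X Y :: "'p set" assume "X \<subseteq> Y"
  then have "attr (high N - Y) \<subseteq> attr (high N - X)" for N
    using attr_superset by (intro attr_least) blast
  then show "evade X \<subseteq> evade Y" unfolding evade_def by blast
qed

lemma bounded_region_unfold: "bounded_region = evade bounded_region"
  unfolding bounded_region_def by (rule lfp_unfold[OF mono_evade])

text \<open>A target position lies outside \<open>evade bounded_region\<close>, hence in the
  attractor for every other height too. So all these attractors coincide, and a position that avoids
  one of them avoids all.\<close>

lemma attr_disjoint_bounded_region: "attr (high N - bounded_region) \<inter> bounded_region = {}"
proof -
  have "high N - bounded_region \<subseteq> attr (high N' - bounded_region)" for N'
    by (subst (1) bounded_region_unfold) (auto simp: evade_def)
  then have "attr (high N - bounded_region) \<subseteq> attr (high N' - bounded_region)" for N'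
    by (rule attr_least)
  then show ?thesis
    by (subst (2) bounded_region_unfold) (auto simp: evade_def)
qed

lemma h_mono:
  assumes "\<And>k. \<exists>u r. q (Suc k) = step (q k) u r" "\<And>k. safe (q k)" "k \<le> l"
  shows "h (q k) \<le> h (q l)"
  using assms(3)
proof (rule lift_Suc_mono_le[rotated])
  fix n show "h (q n) \<le> h (q (Suc n))"
    using assms(1)[of n] assms(2)[of "Suc n"] h_step by metis
qed

text \<open>At \<open>p\<close> the controller avoids the least height \<open>N p\<close> that can
  be avoided outside the positions of smaller rank. By well-foundedness the rank is eventually
  constant, and from then on one value of \<open>N\<close> bounds the height.\<close>

theorem controller_strategy:
  assumes "bounded_region = UNIV"
  shows "\<exists>\<mu>. \<forall>q. (\<forall>k. \<exists>r. q (Suc k) = step (q k) (\<mu> (q k)) r) \<longrightarrow> (\<forall>k. safe (q k)) \<longrightarrow>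
    (\<exists>B. \<forall>k. h (q k) \<le> B)"
proof -
  obtain st where wf: "wf {(x, y). st x \<subset> st y}"
    and in_evade: "\<And>x. x \<in> bounded_region \<Longrightarrow> x \<in> evade (st x)"
    and lower: "\<And>x y. y \<in> st x \<Longrightarrow> st y \<subset> st x"
    and same: "\<And>x y. y \<in> evade (st x) \<Longrightarrow> y \<notin> st x \<Longrightarrow> st y = st x"
    using lfp_stages[OF mono_evade] unfolding bounded_region_def by metis
  define N where "N p = (LEAST N. p \<notin> attr (high N - st p))" for p
  define T where "T p = high (N p) - st p" for p
  have "\<exists>N. p \<notin> attr (high N - st p)" for p
    using in_evade[of p] assms by (simp add: evade_def)
  then have avoid: "p \<notin> attr (T p)" for p
    unfolding T_def N_def by (rule LeastI_ex)
  have "\<exists>u. \<forall>r. step p u r \<notin> attr (T p)" for p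
    using avoid[of p] by (subst (asm) attr_unfold) (auto simp: pre_def)
  then obtain \<mu> where \<mu>: "\<And>p r. step p (\<mu> p) r \<notin> attr (T p)" by metis
  show ?thesis
  proof (intro exI[of _ \<mu>] allI impI)
    fix q assume q: "\<forall>k. \<exists>r. q (Suc k) = step (q k) (\<mu> (q k)) r" and safe: "\<forall>k. safe (q k)"
    have next_attr: "q (Suc k) \<notin> attr (T (q k))" for k
      using q \<mu> by metis
    then have next_evade: "q (Suc k) \<in> evade (st (q k))" for k
      unfolding evade_def T_def by blast
    obtain x where "x \<in> range q" "\<And>y. (y, x) \<in> {(x, y). st x \<subset> st y} \<Longrightarrow> y \<notin> range q"
      using wfE_min[OF wf rangeI[of q 0]] by blast
    then obtain k0 where k0: "\<And>k. \<not> st (q k) \<subset> st (q k0)" by blast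
    txt \<open>The rank never increases, and the bound \<open>N\<close> never increases while the rank is constant.\<close>
    have stable: "st (q k) = st (q k0) \<and> N (q k) \<le> N (q k0)" if "k \<ge> k0" for k
      using that
    proof (induction k rule: dec_induct)
      case (step k)
      then have "q (Suc k) \<notin> st (q k)" using lower[of "q (Suc k)" "q k"] k0[of "Suc k"] by auto
      then have eq: "st (q (Suc k)) = st (q k)" using same next_evade by blast
      then have "N (q (Suc k)) \<le> N (q k)"
        unfolding N_def[of "q (Suc k)"] using next_attr[of k]
        by (intro Least_le) (simp add: T_def)
      then show ?case using step eq by simp
    qed simp
    have "h (q k) \<le> N (q k0)" if "k \<ge> k0" for k
    proof -
      have "q k \<notin> T (q k)" using avoid attr_superset by blast
      moreover have "q k \<notin> st (q k)" using lower by blast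
      ultimately have "h (q k) \<le> N (q k)" using safe by (auto simp: T_def high_def)
      then show ?thesis using stable[OF that] by linarith
    qed
    moreover have "h (q k) \<le> h (q (max k k0))" for k
      using q safe by (intro h_mono) (blast, auto)
    ultimately show "\<exists>B. \<forall>k. h (q k) \<le> B"
      by (meson max.cobounded2 order_trans)
  qed
qed

text \<open>Outside the region every height can be forced. The adversary heads for an integer above
  the current height by lowering the attractor rank. If the height were bounded, the target would
  become constant and the rank would drop forever.\<close>

theorem adversary_strategy:
  assumes "p \<notin> bounded_region"
  shows "\<exists>\<sigma>. \<forall>q. q 0 = p \<longrightarrow> (\<forall>k. \<exists>u. q (Suc k) = step (q k) u (\<sigma> (q k) u)) \<longrightarrow>
    (\<forall>k. safe (q k)) \<and> (\<nexists>B. \<forall>k. h (q k) \<le> B)"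
proof -
  define T where "T N = high N - bounded_region" for N
  have "\<exists>st. wf {(x, y). st x \<subset> st y} \<and> (\<forall>x. st x \<subseteq> attr (T N)) \<and>
      (\<forall>x\<in>attr (T N). x \<in> pre (T N) (st x)) \<and> (\<forall>x y. y \<in> st x \<longrightarrow> st y \<subset> st x)" for N
    using lfp_stages[OF mono_pre[of "T N"]] unfolding attr_def by metis
  then obtain st where wf: "\<And>N. wf {(x, y). st N x \<subset> st N y}"
    and st_sub: "\<And>N x. st N x \<subseteq> attr (T N)"
    and in_pre: "\<And>N x. x \<in> attr (T N) \<Longrightarrow> x \<in> pre (T N) (st N x)"
    and lower: "\<And>N x y. y \<in> st N x \<Longrightarrow> st N y \<subset> st N x"
    by metis
  \<comment> \<open>A positive integer strictly above \<open>h p\<close>, so \<open>p\<close> is not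
    in its own target and its rank can still drop.\<close>
  define N where "N p = nat \<lfloor>h p\<rfloor> + 1" for p
  have "\<exists>r. step p u r \<in> st (N p) p" if "p \<notin> bounded_region" for p u
  proof -
    have "p \<in> attr (T (N p))"
      using that by (subst (asm) bounded_region_unfold) (auto simp: evade_def T_def)
    moreover have "p \<notin> T (N p)" unfolding T_def high_def N_def by simp linarith
    ultimately show ?thesis using in_pre unfolding pre_def by blast
  qed
  then obtain \<sigma> where \<sigma>: "\<And>p u. p \<notin> bounded_region \<Longrightarrow> step p u (\<sigma> p u) \<in> st (N p) p" by metis
  show ?thesis
  proof (intro exI[of _ \<sigma>] allI impI)
    fix q assume q0: "q 0 = p" and q: "\<forall>k. \<exists>u. q (Suc k) = step (q k) u (\<sigma> (q k) u)"
    have outside: "q k \<notin> bounded_region" for k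
    proof (induction k)
      case (Suc k)
      then have "q (Suc k) \<in> attr (T (N (q k)))" using \<sigma> st_sub q by (metis subsetD)
      then show ?case using attr_disjoint_bounded_region unfolding T_def by blast
    qed (simp add: q0 assms)
    have in_st: "q (Suc k) \<in> st (N (q k)) (q k)" for k
      using \<sigma> outside q by metis
    have safe: "safe (q k)" for k
      using outside[of k] attr_high_safe
      by (subst (asm) bounded_region_unfold) (auto simp: evade_def)
    have "\<not> (\<forall>k. h (q k) \<le> B)" for B
    proof
      assume B: "\<forall>k. h (q k) \<le> B"
      have "h (q k) \<le> h (q (Suc k))" for k
        using q safe by (intro h_mono) (blast, auto)
      then have "incseq (\<lambda>k. N (q k))"
        unfolding N_def by (intro incseq_SucI) (simp add: floor_mono nat_mono)
      moreover have "N (q k) \<le> nat \<lfloor>B\<rfloor> + 1" for k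
        unfolding N_def using B by (simp add: floor_mono nat_mono)
      ultimately have "\<exists>k0. \<forall>k\<ge>k0. N (q k) = N (q k0)"
        by (rule bounded_incseq_nat_eventually_const)
      then obtain k0 where const: "\<And>k. k0 \<le> k \<Longrightarrow> N (q k) = N (q k0)" by blast
      obtain x where x: "x \<in> q ` {k0..}" and min: "\<And>y. st (N (q k0)) y \<subset> st (N (q k0)) x \<Longrightarrow> y \<notin> q ` {k0..}"
        using wfE_min[OF wf[of "N (q k0)"], of "q k0" "q ` {k0..}"] by auto
      then obtain k where k: "k \<ge> k0" "x = q k" by auto
      then show False using min[of "q (Suc k)"] lower[OF in_st[of k]] const[OF k(1)] by auto
    qed
    then show "(\<forall>k. safe (q k)) \<and> (\<nexists>B. \<forall>k. h (q k) \<le> B)" using safe by blast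
  qed
qed

end

section \<open>Kirszbraun extension\<close>

lemma kirszbraun_finite:
  fixes D :: "('a::euclidean_space \<times> 'b::euclidean_space) set"
  assumes "finite D"
    and lip: "\<And>p q. p \<in> D \<Longrightarrow> q \<in> D \<Longrightarrow> norm (snd p - snd q) \<le> L * norm (fst p - fst q)"
    and "0 \<le> L"
  shows "\<exists>y. \<forall>p\<in>D. norm (y - snd p) \<le> L * norm (x - fst p)"
proof (cases "D = {}")
  case False
  define g :: "'a \<times> 'b \<Rightarrow> 'b \<times> real \<times> 'a"
    where "g p = (snd p, norm (snd p) ^ 2 - (L * norm (x - fst p)) ^ 2, x - fst p)" for p
  define P where "P = convex hull (g ` D)"
  txt \<open>The wanted point is the first component of a maximizer of \<open>\<psi>\<close> on \<open>P\<close>: the first order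
    condition gives \<open>norm (y - snd p) ^ 2 - (L * norm (x - fst p)) ^ 2 \<le> max \<psi>\<close>, and \<open>\<psi> z \<le> \<beta> z z / 2 \<le> 0\<close>
    because \<open>\<beta>\<close> is affine in each argument and nonpositive on the generators by the Lipschitz
    condition.\<close>
  define \<psi> :: "'b \<times> real \<times> 'a \<Rightarrow> real" where "\<psi> z = fst (snd z) - norm (fst z) ^ 2" for z
  define \<beta> :: "'b \<times> real \<times> 'a \<Rightarrow> 'b \<times> real \<times> 'a \<Rightarrow> real"
    where "\<beta> z w = fst (snd z) + fst (snd w) - 2 * (fst z \<bullet> fst w) +
      2 * L ^ 2 * (snd (snd z) \<bullet> snd (snd w))" for z w
  have \<beta>_sym: "\<beta> z w = \<beta> w z" for z w
    unfolding \<beta>_def by (simp add: inner_commute)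
  have convex_\<beta>: "convex {w. \<beta> z w \<le> 0}" for z
  proof (rule convexI)
    fix v w and s t :: real
    assume *: "v \<in> {w. \<beta> z w \<le> 0}" "w \<in> {w. \<beta> z w \<le> 0}" "0 \<le> s" "0 \<le> t" "s + t = 1"
    have s: "s = 1 - t" using * by simp
    have "\<beta> z (s *\<^sub>R v + t *\<^sub>R w) = s * \<beta> z v + t * \<beta> z w"
      unfolding \<beta>_def s by (simp add: inner_add_right algebra_simps)
    also have "\<dots> \<le> 0" using * by (auto intro!: add_nonpos_nonpos mult_nonneg_nonpos)
    finally show "s *\<^sub>R v + t *\<^sub>R w \<in> {w. \<beta> z w \<le> 0}" by simp
  qed
  have \<beta>_g: "\<beta> (g p) (g q) \<le> 0" if "p \<in> D" "q \<in> D" for p q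
  proof -
    have "\<beta> (g p) (g q) = norm (snd p - snd q) ^ 2 - (L * norm (fst p - fst q)) ^ 2"
      unfolding \<beta>_def g_def power_mult_distrib power2_norm_eq_inner
      by (simp add: inner_diff_left inner_diff_right inner_commute algebra_simps)
    also have "\<dots> \<le> 0" using lip[OF that] by (simp add: power_mono)
    finally show ?thesis .
  qed
  have hull_\<beta>: "P \<subseteq> {w. \<beta> z w \<le> 0}" if "\<And>p. p \<in> D \<Longrightarrow> \<beta> z (g p) \<le> 0" for z
    unfolding P_def by (rule hull_minimal) (use that convex_\<beta> in auto)
  have "\<beta> w (g p) \<le> 0" if "p \<in> D" "w \<in> P" for p w
    using hull_\<beta>[of "g p"] \<beta>_g that \<beta>_sym[of w] by auto
  then have \<beta>_P: "\<beta> z w \<le> 0" if "z \<in> P" "w \<in> P" for z w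
    using hull_\<beta>[of z] that by blast
  have \<psi>_nonpos: "\<psi> z \<le> 0" if "z \<in> P" for z
  proof -
    have "2 * \<psi> z + 2 * L ^ 2 * norm (snd (snd z)) ^ 2 = \<beta> z z"
      unfolding \<psi>_def \<beta>_def power2_norm_eq_inner by simp
    also have "\<dots> \<le> 0" by (rule \<beta>_P[OF that that])
    finally have "2 * \<psi> z + 2 * L ^ 2 * norm (snd (snd z)) ^ 2 \<le> 0" .
    moreover have "0 \<le> 2 * L ^ 2 * norm (snd (snd z)) ^ 2" by simp
    ultimately show ?thesis by linarith
  qed
  have "compact P" unfolding P_def by (intro finite_imp_compact_convex_hull finite_imageI assms)
  moreover have "P \<noteq> {}" unfolding P_def using False by simp
  moreover have "continuous_on P \<psi>" unfolding \<psi>_def by (intro continuous_intros)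
  ultimately have "\<exists>z\<in>P. \<forall>w\<in>P. \<psi> w \<le> \<psi> z" by (rule continuous_attains_sup)
  then obtain z where z: "z \<in> P" "\<And>w. w \<in> P \<Longrightarrow> \<psi> w \<le> \<psi> z" by blast
  have "norm (fst z - snd p) \<le> L * norm (x - fst p)" if "p \<in> D" for p
  proof -
    define d where "d = fst (snd (g p)) - fst (snd z) - 2 * (fst z \<bullet> (snd p - fst z))"
    define n where "n = norm (snd p - fst z) ^ 2"
    \<comment> \<open>The segment from \<open>z\<close> to \<open>g p\<close> stays in
      \<open>P\<close>. Since \<open>\<psi>\<close> is quadratic, comparison with the maximum is
      exact; divide by \<open>t\<close>, then let \<open>t\<close> tend to 0.\<close>
    have "d \<le> t * n" if t: "0 < t" "t \<le> 1" for t
    proof -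
      have "(1 - t) *\<^sub>R z + t *\<^sub>R g p \<in> P"
        using z(1) \<open>p \<in> D\<close> t hull_subset[of "g ` D" convex] unfolding P_def
        by (intro convexD_alt) (auto intro: convex_convex_hull)
      then have "\<psi> ((1 - t) *\<^sub>R z + t *\<^sub>R g p) \<le> \<psi> z" by (rule z(2))
      moreover have "\<psi> ((1 - t) *\<^sub>R z + t *\<^sub>R g p) - \<psi> z = t * (d - t * n)"
        unfolding \<psi>_def d_def n_def g_def power2_norm_eq_inner
        by (simp add: inner_diff_left inner_diff_right inner_add_left inner_add_right
            inner_commute power2_eq_square algebra_simps)
      ultimately have "t * (d - t * n) \<le> 0" by linarith
      then show ?thesis using t by (simp add: mult_le_0_iff)
    qed
    note small = this
    have "d \<le> 0"
    proof (rule ccontr)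
      assume "\<not> d \<le> 0"
      \<comment> \<open>Chosen so that \<open>t * n\<close> is at most \<open>d / 2\<close>.\<close>
      define t where "t = min 1 (d / (2 * (n + 1)))"
      have "n \<ge> 0" unfolding n_def by simp
      then have t: "0 < t" "t \<le> 1" "t \<le> d / (2 * (n + 1))"
        using \<open>\<not> d \<le> 0\<close> by (auto simp: t_def)
      have "t * n \<le> t * (n + 1)" using t by simp
      also have "\<dots> \<le> d / 2" using t(3) \<open>n \<ge> 0\<close> by (simp add: field_simps)
      finally show False using small[OF t(1,2)] \<open>\<not> d \<le> 0\<close> by linarith
    qed
    moreover have "norm (fst z - snd p) ^ 2 - (L * norm (x - fst p)) ^ 2 = d + \<psi> z"
      unfolding \<psi>_def d_def g_def power2_norm_eq_inner
      by (simp add: inner_diff_left inner_diff_right inner_commute algebra_simps)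
    ultimately have "norm (fst z - snd p) ^ 2 \<le> (L * norm (x - fst p)) ^ 2"
      using \<psi>_nonpos[OF z(1)] by linarith
    then show ?thesis by (rule power2_le_imp_le) (use \<open>0 \<le> L\<close> in simp)
  qed
  then show ?thesis by blast
qed simp

text \<open>Partial maps as sets of pairs, so that Zorn's lemma applies to inclusion; the inequality
  forces single-valuedness.\<close>

definition lip_graph :: "real \<Rightarrow> ('a::euclidean_space \<times> 'b::euclidean_space) set \<Rightarrow> bool" where
  "lip_graph L G \<longleftrightarrow> (\<forall>p\<in>G. \<forall>q\<in>G. norm (snd p - snd q) \<le> L * norm (fst p - fst q))"

text \<open>The admissible values form an intersection of closed balls. Finitely many of them meet
  by the finite case, so compactness settles the rest.\<close>

lemma lip_graph_one_point:
  fixes G :: "('a::euclidean_space \<times> 'b::euclidean_space) set"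
  assumes "lip_graph L G" "0 \<le> L"
  shows "\<exists>y. \<forall>p\<in>G. norm (y - snd p) \<le> L * norm (x - fst p)"
proof (cases "G = {}")
  case False
  then obtain p0 where "p0 \<in> G" by blast
  define B :: "'a \<times> 'b \<Rightarrow> 'b set" where "B p = cball (snd p) (L * norm (x - fst p))" for p
  have in_B: "y \<in> B p \<longleftrightarrow> norm (y - snd p) \<le> L * norm (x - fst p)" for y p
    unfolding B_def by (simp add: dist_norm norm_minus_commute)
  have "B p0 \<inter> (\<Inter>p\<in>G. B p) \<noteq> {}"
  proof (rule compact_imp_fip_image)
    fix F assume F: "finite F" "F \<subseteq> G"
    have "\<exists>y. \<forall>p\<in>insert p0 F. norm (y - snd p) \<le> L * norm (x - fst p)"
      using F assms \<open>p0 \<in> G\<close> by (intro kirszbraun_finite) (auto simp: lip_graph_def)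
    then show "B p0 \<inter> (\<Inter>p\<in>F. B p) \<noteq> {}"
      using in_B by blast
  qed (auto simp: B_def)
  then show ?thesis using in_B by blast
qed simp

text \<open>Zorn's lemma. With \<open>D\<close> the whole space it yields total maps, with
  \<open>D\<close> a set of data it selects a subset to which all the data stay close.\<close>

lemma lip_graph_maximal:
  assumes "lip_graph L G" "G \<subseteq> D"
  obtains M where "lip_graph L M" "G \<subseteq> M" "M \<subseteq> D"
    "\<And>p. p \<in> D \<Longrightarrow> lip_graph L (insert p M) \<Longrightarrow> p \<in> M"
proof -
  define A where "A = {M. lip_graph L M \<and> G \<subseteq> M \<and> M \<subseteq> D}"
  have "\<exists>M\<in>A. \<forall>X\<in>A. M \<subseteq> X \<longrightarrow> X = M"
  proof (rule subset_Zorn_nonempty)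
    show "A \<noteq> {}" using assms unfolding A_def by blast
    fix C assume C: "C \<noteq> {}" "subset.chain A C"
    have "lip_graph L (\<Union>C)"
      unfolding lip_graph_def
    proof (intro ballI)
      fix p q assume "p \<in> \<Union>C" "q \<in> \<Union>C"
      then obtain X where "X \<in> C" "p \<in> X" "q \<in> X"
        using C(2) unfolding subset_chain_def by blast
      then show "norm (snd p - snd q) \<le> L * norm (fst p - fst q)"
        using C(2) unfolding subset_chain_def A_def lip_graph_def by blast
    qed
    moreover have "G \<subseteq> \<Union>C" "\<Union>C \<subseteq> D"
      using C unfolding subset_chain_def A_def by blast+
    ultimately show "\<Union>C \<in> A" unfolding A_def by blast
  qed
  then obtain M where M: "M \<in> A" "\<And>X. X \<in> A \<Longrightarrow> M \<subseteq> X \<Longrightarrow> X = M" by blast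
  show thesis
  proof
    show "lip_graph L M" "G \<subseteq> M" "M \<subseteq> D" using M(1) unfolding A_def by auto
    show "p \<in> M" if "p \<in> D" "lip_graph L (insert p M)" for p
      using M(1) M(2)[of "insert p M"] that unfolding A_def by blast
  qed
qed

text \<open>A maximal graph is total, since a missing argument could be added by the one-point
  extension.\<close>

theorem kirszbraun:
  fixes G :: "('a::euclidean_space \<times> 'b::euclidean_space) set"
  assumes "lip_graph L G" "0 \<le> L"
  obtains f where "\<And>x y. norm (f x - f y) \<le> L * norm (x - y)" "\<And>p. p \<in> G \<Longrightarrow> f (fst p) = snd p"
proof -
  obtain M where M: "lip_graph L M" "G \<subseteq> M" "\<And>p. lip_graph L (insert p M) \<Longrightarrow> p \<in> M"
    using lip_graph_maximal[OF assms(1) subset_UNIV] by (metis UNIV_I)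
  have "\<exists>y. (x, y) \<in> M" for x
  proof -
    obtain y where "\<forall>p\<in>M. norm (y - snd p) \<le> L * norm (x - fst p)"
      using lip_graph_one_point[OF M(1) assms(2)] by blast
    then have "lip_graph L (insert (x, y) M)"
      using M(1) by (auto simp: lip_graph_def norm_minus_commute)
    then show ?thesis using M(3) by blast
  qed
  then obtain f where f: "\<And>x. (x, f x) \<in> M" by metis
  show thesis
  proof
    show "norm (f x - f y) \<le> L * norm (x - y)" for x y
      using M(1)[unfolded lip_graph_def, rule_format, OF f[of x] f[of y]] by simp
    show "f (fst p) = snd p" if "p \<in> G" for p
    proof -
      have "norm (f (fst p) - snd p) \<le> L * norm (fst p - fst p)"
        using M(1)[unfolded lip_graph_def, rule_format, OF f[of "fst p"], of p] M(2) that by auto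
      then show ?thesis by simp
    qed
  qed
qed

text \<open>Points outside a maximal \<open>L\<close>-Lipschitz subset \<open>G\<close> of \<open>D\<close> violate the Lipschitz condition with
  some point of \<open>G\<close>; as \<open>l < L\<close>, they are close to it.\<close>

lemma coarse_lipschitz_extension:
  fixes D :: "('a::euclidean_space \<times> 'b::euclidean_space) set"
  assumes D: "\<And>p q. p \<in> D \<Longrightarrow> q \<in> D \<Longrightarrow> norm (snd p - snd q) \<le> l * norm (fst p - fst q) + M"
    and "0 \<le> l" "l < L"
  obtains f B where "\<And>x y. norm (f x - f y) \<le> L * norm (x - y)"
    "\<And>p. p \<in> D \<Longrightarrow> norm (f (fst p) - snd p) \<le> B"
proof -
  have "lip_graph L ({} :: ('a \<times> 'b) set)" by (simp add: lip_graph_def)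
  then obtain G where G: "lip_graph L G" "G \<subseteq> D"
      "\<And>p. p \<in> D \<Longrightarrow> lip_graph L (insert p G) \<Longrightarrow> p \<in> G"
    using lip_graph_maximal[OF _ empty_subsetI] by metis
  obtain f where f: "\<And>x y. norm (f x - f y) \<le> L * norm (x - y)" "\<And>p. p \<in> G \<Longrightarrow> f (fst p) = snd p"
    using kirszbraun[OF G(1)] assms(2,3) by (metis less_eq_real_def order_trans)
  \<comment> \<open>If \<open>p\<close> and \<open>q\<close> violate the condition for
    \<open>L\<close> but satisfy the one for \<open>l\<close> up to \<open>M\<close>, then
    \<open>(L - l) * norm (fst p - fst q)\<close> is below \<open>M\<close>. The absolute value
    makes \<open>\<delta>\<close> nonnegative, which covers the points of \<open>G\<close>.\<close>
  define \<delta> where "\<delta> = \<bar>M\<bar> / (L - l)"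
  have near: "\<exists>q\<in>G. norm (fst p - fst q) \<le> \<delta>" if "p \<in> D" for p
  proof (cases "p \<in> G")
    case True
    then show ?thesis using assms(3) by (intro bexI[of _ p]) (auto simp: \<delta>_def)
  next
    case False
    then have "\<not> lip_graph L (insert p G)" using G(3) that by blast
    then obtain q where q: "q \<in> G" "norm (snd p - snd q) > L * norm (fst p - fst q)"
      using G(1) unfolding lip_graph_def by (force simp: norm_minus_commute)
    then have "L * norm (fst p - fst q) \<le> l * norm (fst p - fst q) + M"
      using D[OF that, of q] G(2) by auto
    then have "norm (fst p - fst q) * (L - l) \<le> \<bar>M\<bar>" by (simp add: algebra_simps)
    then have "norm (fst p - fst q) \<le> \<delta>"
      unfolding \<delta>_def using assms(3) by (simp add: pos_le_divide_eq)
    then show ?thesis using q(1) by blast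
  qed
  show thesis
  proof
    fix p assume "p \<in> D"
    then obtain q where q: "q \<in> G" "norm (fst p - fst q) \<le> \<delta>" using near by blast
    have "norm (f (fst p) - snd p) = norm ((f (fst p) - f (fst q)) - (snd p - snd q))"
      by (simp add: f(2)[OF q(1)])
    also have "\<dots> \<le> norm (f (fst p) - f (fst q)) + norm (snd p - snd q)"
      by (rule norm_triangle_ineq4)
    also have "\<dots> \<le> L * norm (fst p - fst q) + (l * norm (fst p - fst q) + M)"
      using f(1) D[OF \<open>p \<in> D\<close>] q(1) G(2) by (intro add_mono) auto
    also have "\<dots> \<le> L * \<delta> + (l * \<delta> + M)"
      using q(2) assms by (intro add_mono mult_left_mono) auto
    finally show "norm (f (fst p) - snd p) \<le> L * \<delta> + (l * \<delta> + M)" .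
  qed (rule f(1))
qed

section \<open>The escape game\<close>

lemma Env_le_iff:
  assumes "0 \<le> M"
  shows "Env l (xs, rs) \<le> M \<longleftrightarrow>
    (\<forall>i<length rs. \<forall>j<length rs. norm (rs ! i - rs ! j) \<le> l * norm (xs ! i - xs ! j) + M)"
proof (cases "rs = []")
  case True
  then show ?thesis using assms by (simp add: Env_def)
next
  case False
  define g where "g = (\<lambda>(i, j). max (norm (rs ! i - rs ! j) - l * norm (xs ! i - xs ! j)) 0)"
  define I where "I = {..<length rs} \<times> {..<length rs}"
  have "Env l (xs, rs) = Max (g ` I)"
    using False unfolding Env_def g_def I_def by simp
  moreover have "finite (g ` I)" "g ` I \<noteq> {}" using False by (auto simp: I_def)
  ultimately have "Env l (xs, rs) \<le> M \<longleftrightarrow> (\<forall>p\<in>I. g p \<le> M)"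
    by (simp add: Max_le_iff)
  then show ?thesis using assms by (auto simp: g_def I_def algebra_simps)
qed

lemma rad_le_iff:
  "rad (xs, rs) \<le> B \<longleftrightarrow> (\<forall>i\<le>length rs. norm (xs ! i - xs ! 0) \<le> B)"
  unfolding rad_def by (auto simp: Max_le_iff)

lemma is_history_successor: "is_history (successor H u r) \<longleftrightarrow> is_history H"
  by (simp add: is_history_def successor_def case_prod_beta)

lemma Env_successor_le:
  assumes "is_history H" "0 \<le> M" "Env l (successor H u r) \<le> M"
  shows "Env l H \<le> M"
proof -
  obtain xs rs where H: "H = (xs, rs)" by fastforce
  have *: "\<forall>i<length (rs @ [r]). \<forall>j<length (rs @ [r]).
      norm ((rs @ [r]) ! i - (rs @ [r]) ! j) \<le> l * norm ((xs @ [u + r]) ! i - (xs @ [u + r]) ! j) + M"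
    using assms(3) unfolding H successor_def case_prod_conv Env_le_iff[OF assms(2)] .
  show ?thesis
    unfolding H Env_le_iff[OF assms(2)]
  proof (intro allI impI)
    fix i j assume "i < length rs" "j < length rs"
    then show "norm (rs ! i - rs ! j) \<le> l * norm (xs ! i - xs ! j) + M"
      using *[rule_format, of i j] assms(1) by (simp add: H is_history_def nth_append)
  qed
qed

lemma rad_successor_ge:
  assumes "is_history H"
  shows "rad H \<le> rad (successor H u r)"
proof -
  obtain xs rs where H: "H = (xs, rs)" by fastforce
  define B where "B = rad (successor H u r)"
  have "rad (successor H u r) \<le> B" by (simp add: B_def)
  then have *: "\<forall>i\<le>length (rs @ [r]). norm ((xs @ [u + r]) ! i - (xs @ [u + r]) ! 0) \<le> B"
    unfolding H successor_def case_prod_conv rad_le_iff .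
  have "xs \<noteq> []" using assms by (auto simp: H is_history_def)
  then have "norm (xs ! i - xs ! 0) \<le> B" if "i \<le> length rs" for i
    using *[rule_format, of i] assms that by (simp add: H is_history_def nth_append)
  then show ?thesis unfolding B_def[symmetric] unfolding H rad_le_iff by blast
qed

text \<open>A fixed bound on the envelope is a safety condition, because neither envelope nor radius
  decreases when a history grows. Pairs of lists of the wrong lengths count as unsafe.\<close>

lemma escape_pursuit_game:
  "pursuit_game successor (\<lambda>H. is_history H \<and> Env l H \<le> real M) rad"
  by standard (auto simp: is_history_successor intro: rad_successor_ge Env_successor_le)

section \<open>Plays and controllers of the escape game\<close>

lemma SUP_ereal_eq_PInf_iff:
  "(SUP k. ereal (f k)) = \<infinity> \<longleftrightarrow> (\<nexists>B. \<forall>k. f k \<le> B)"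
proof
  assume *: "(SUP k. ereal (f k)) = \<infinity>"
  show "\<nexists>B. \<forall>k. f k \<le> B"
  proof
    assume "\<exists>B. \<forall>k. f k \<le> B"
    then obtain B where "\<And>k. f k \<le> B" by blast
    then have "(SUP k. ereal (f k)) \<le> ereal B" by (intro SUP_least) simp
    then show False using * by simp
  qed
next
  assume "\<nexists>B. \<forall>k. f k \<le> B"
  then show "(SUP k. ereal (f k)) = \<infinity>"
    by (intro SUP_PInfty) (metis UNIV_I ereal_less_eq(3) linear)
qed

lemma play_hist_resulting_play: "play_hist (resulting_play H \<mu> \<sigma>) k = hist_seq H \<mu> \<sigma> k"
  by (simp add: play_hist_def resulting_play_def Let_def)

lemma resulting_play_Esc_iff:
  "resulting_play H \<mu> \<sigma> \<in> Esc l H \<longleftrightarrow>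
    (\<exists>M. \<forall>k. Env l (hist_seq H \<mu> \<sigma> k) \<le> M) \<and> (\<nexists>B. \<forall>k. rad (hist_seq H \<mu> \<sigma> k) \<le> B)"
  unfolding Esc_def mem_Collect_eq Env_inf_def play_hist_resulting_play ereal_infty_less(1)
    SUP_ereal_eq_PInf_iff
  using is_play_resulting_play by blast

text \<open>Outside \<open>bounded_region\<close> the adversary could keep the envelope below
  \<open>M\<close> and the radius unbounded against every controller, and so win the escape
  game.\<close>

lemma bounding_controller:
  assumes "winning_histories l = ({} :: 'a::euclidean_space history set)"
  shows "\<exists>\<mu> :: 'a controller. \<forall>q. (\<forall>k. \<exists>r. q (Suc k) = successor (q k) (\<mu> (q k)) r) \<longrightarrow>
    (\<forall>k. is_history (q k) \<and> Env l (q k) \<le> real M) \<longrightarrow> (\<exists>B. \<forall>k. rad (q k) \<le> B)"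
proof -
  interpret pursuit_game "successor :: 'a history \<Rightarrow> _" "\<lambda>H. is_history H \<and> Env l H \<le> real M" rad
    by (rule escape_pursuit_game)
  have "p \<in> bounded_region" for p :: "'a history"
  proof (rule ccontr)
    assume "p \<notin> bounded_region"
    then obtain \<sigma> where \<sigma>: "\<forall>q. q 0 = p \<longrightarrow> (\<forall>k. \<exists>u. q (Suc k) = successor (q k) u (\<sigma> (q k) u)) \<longrightarrow>
        (\<forall>k. is_history (q k) \<and> Env l (q k) \<le> real M) \<and> (\<nexists>B. \<forall>k. rad (q k) \<le> B)"
      by (rule adversary_strategy[THEN exE])
    have play: "(\<forall>k. is_history (hist_seq p \<mu> \<sigma> k) \<and> Env l (hist_seq p \<mu> \<sigma> k) \<le> real M) \<and>
        (\<nexists>B. \<forall>k. rad (hist_seq p \<mu> \<sigma> k) \<le> B)" for \<mu>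
      by (rule \<sigma>[rule_format]) (auto simp: Let_def)
    then have "is_history p" by (metis hist_seq.simps(1))
    moreover have "adversary_wins l p"
      unfolding adversary_wins_def resulting_play_Esc_iff using play by blast
    ultimately show False using assms unfolding winning_histories_def by blast
  qed
  then show ?thesis by (intro controller_strategy) auto
qed

lemma universal_bounding_controller:
  fixes l :: "nat \<Rightarrow> real"
  assumes "\<And>j. winning_histories (l j) = ({} :: 'a::euclidean_space history set)"
  shows "\<exists>\<mu> :: 'a controller. \<forall>q j M. (\<forall>k. \<exists>r. q (Suc k) = successor (q k) (\<mu> (q k)) r) \<longrightarrow>
    (\<forall>k. is_history (q k) \<and> Env (l j) (q k) \<le> M) \<longrightarrow> (\<exists>B. \<forall>k. rad (q k) \<le> B)"
proof -
  define P where "P n H \<longleftrightarrow> Env (l (fst (prod_decode n))) H \<le> real (snd (prod_decode n))"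
    for n and H :: "'a history"
  have "\<exists>\<mu> :: 'a controller. \<forall>q. (\<forall>k. \<exists>r. q (Suc k) = successor (q k) (\<mu> (q k)) r) \<longrightarrow>
    (\<forall>k. is_history (q k) \<and> P n (q k)) \<longrightarrow> (\<exists>B. \<forall>k. rad (q k) \<le> B)" for n
    unfolding P_def by (intro bounding_controller assms)
  then obtain \<mu> :: "nat \<Rightarrow> 'a controller" where \<mu>:
    "\<And>n q. (\<And>k. \<exists>r. q (Suc k) = successor (q k) (\<mu> n (q k)) r) \<Longrightarrow>
      (\<And>k. is_history (q k) \<and> P n (q k)) \<Longrightarrow> \<exists>B. \<forall>k. rad (q k) \<le> B"
    by metis
  txt \<open>Stages enumerate the pairs of a level \<open>l j\<close> and an envelope bound. The least stage consistent
    with the history can only grow, and it stays below every pair that is valid for the whole play.\<close>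
  define stage where "stage H = (LEAST n. P n H)" for H
  show ?thesis
  proof (intro exI[of _ "\<lambda>H. \<mu> (stage H) H"] allI impI)
    fix q :: "nat \<Rightarrow> 'a history" and j and M :: real
    assume q: "\<forall>k. \<exists>r. q (Suc k) = successor (q k) (\<mu> (stage (q k)) (q k)) r"
      and Env: "\<forall>k. is_history (q k) \<and> Env (l j) (q k) \<le> M"
    define N where "N = prod_encode (j, nat \<lceil>M\<rceil>)"
    have P_N: "P N (q k)" for k
    proof -
      have "M \<le> real (nat \<lceil>M\<rceil>)" by linarith
      moreover have "Env (l j) (q k) \<le> M" using Env by blast
      ultimately show ?thesis unfolding P_def N_def by simp
    qed
    have P_stage: "P (stage (q k)) (q k)" for k
      unfolding stage_def using P_N by (rule LeastI)
    \<comment> \<open>A pair once refuted stays refuted, as the envelope never decreases.\<close>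
    have P_Suc: "P n (q k)" if "P n (q (Suc k))" for n k
      using q[rule_format, of k] Env[rule_format, of k] that Env_successor_le unfolding P_def
      by (metis of_nat_0_le_iff)
    have "incseq (\<lambda>k. stage (q k))"
      by (rule incseq_SucI) (metis P_Suc P_stage stage_def Least_le)
    moreover have "stage (q k) \<le> N" for k
      unfolding stage_def using P_N by (rule Least_le)
    ultimately have "\<exists>k0. \<forall>k\<ge>k0. stage (q k) = stage (q k0)"
      by (rule bounded_incseq_nat_eventually_const)
    then obtain k0 where k0: "\<And>k. k0 \<le> k \<Longrightarrow> stage (q k) = stage (q k0)" by blast
    \<comment> \<open>From \<open>k0\<close> on the play follows a single bounding controller, whose
      guarantee holds from any initial history.\<close>
    have "\<exists>B. \<forall>k. rad (q (k + k0)) \<le> B"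
    proof (rule \<mu>[of _ "stage (q k0)"])
      show "\<exists>r. q (Suc k + k0) = successor (q (k + k0)) (\<mu> (stage (q k0)) (q (k + k0))) r" for k
        using q[rule_format, of "k + k0"] k0[of "k + k0"] by simp
      show "is_history (q (k + k0)) \<and> P (stage (q k0)) (q (k + k0))" for k
        using Env P_stage[of "k + k0"] k0[of "k + k0"] by simp
    qed
    then obtain B where B: "\<And>k. rad (q (k + k0)) \<le> B" by blast
    have "incseq (\<lambda>k. rad (q k))"
      by (rule incseq_SucI) (metis Env q rad_successor_ge)
    then have "rad (q k) \<le> B" for k
      using incseqD[of "\<lambda>k. rad (q k)" k "k + k0"] B[of k] by simp
    then show "\<exists>B. \<forall>k. rad (q k) \<le> B" by blast
  qed
qed

section \<open>Coarse Lipschitz plants and feedback laws\<close>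

lemma gL_norm_less_imp:
  assumes "gL_norm f < ereal l"
  obtains \<alpha> where "\<alpha> > 0" "\<And>x y. norm (f x - f y) \<le> l * (norm (x - y) + \<alpha>)"
proof -
  have "\<forall>\<^sub>F \<alpha> in at_top. gL_quot f \<alpha> < ereal l"
    by (rule order_tendstoD(2)[OF gL_norm_tendsto assms])
  with eventually_gt_at_top[of "0 :: real"]
  have "\<forall>\<^sub>F \<alpha> in at_top. 0 < \<alpha> \<and> gL_quot f \<alpha> < ereal l"
    by (rule eventually_conj)
  then have "\<exists>\<alpha>. 0 < \<alpha> \<and> gL_quot f \<alpha> < ereal l"
    by (rule eventually_happens'[OF trivial_limit_at_top_linorder])
  then obtain \<alpha> where \<alpha>: "\<alpha> > 0" "gL_quot f \<alpha> < ereal l" by blast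
  show thesis
  proof
    fix x y
    have "ereal (norm (f x - f y) / (norm (x - y) + \<alpha>)) \<le> gL_quot f \<alpha>"
      unfolding gL_quot_def by (rule SUP_upper2[of "(x, y)"]) auto
    then have "norm (f x - f y) / (norm (x - y) + \<alpha>) \<le> l" using \<alpha>(2) by (meson ereal_less_eq(3) less_imp_le order_trans)
    moreover have "norm (x - y) + \<alpha> > 0" using \<alpha>(1) by (simp add: add_nonneg_pos)
    ultimately show "norm (f x - f y) \<le> l * (norm (x - y) + \<alpha>)" by (simp add: pos_divide_le_eq)
  qed (rule \<alpha>(1))
qed

lemma gL_norm_le_lipschitz:
  assumes "\<And>x y. norm (f x - f y) \<le> L * norm (x - y)" "0 \<le> L"
  shows "gL_norm f \<le> ereal L"
proof (rule tendsto_upperbound[OF gL_norm_tendsto _ trivial_limit_at_top_linorder])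
  have "gL_quot f \<alpha> \<le> ereal L" if "\<alpha> > 0" for \<alpha>
    unfolding gL_quot_def
  proof (rule SUP_least, clarify)
    fix x y
    have "norm (f x - f y) \<le> L * (norm (x - y) + \<alpha>)"
      using assms(1)[of x y] mult_nonneg_nonneg[OF assms(2), of \<alpha>] that by (simp add: distrib_left)
    moreover have "norm (x - y) + \<alpha> > 0" using that by (simp add: add_nonneg_pos)
    ultimately show "ereal (norm (f x - f y) / (norm (x - y) + \<alpha>)) \<le> ereal L"
      by (simp add: pos_divide_le_eq)
  qed
  then show "\<forall>\<^sub>F \<alpha> in at_top. gL_quot f \<alpha> \<le> ereal L"
    using eventually_gt_at_top[of 0] by (rule eventually_mono[rotated])
qed

text \<open>States and inputs reveal the responses
  \<open>x (Suc i) - u i = f (x i) + w (Suc i)\<close>, so the law can run a game controller on the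
  history. The bound on \<open>gL_norm f\<close> and the bounded disturbance keep its envelope
  bounded.\<close>

lemma stabilizing_feedback:
  fixes l :: "nat \<Rightarrow> real"
  assumes "\<And>j. winning_histories (l j) = ({} :: 'a::euclidean_space history set)"
  shows "\<exists>S :: 'a feedback. \<forall>j x0 f w. gL_norm f < ereal (l j) \<and> bounded (w ` {1..}) \<longrightarrow>
    bounded (range (closed_loop_state f S w x0))"
proof -
  obtain \<mu> :: "'a controller" where \<mu>:
    "\<And>q j M. (\<And>k. \<exists>r. q (Suc k) = successor (q k) (\<mu> (q k)) r) \<Longrightarrow>
      (\<And>k. is_history (q k) \<and> Env (l j) (q k) \<le> M) \<Longrightarrow> \<exists>B. \<forall>k. rad (q k) \<le> B"
    using universal_bounding_controller[of l, OF assms] by metis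
  define S :: "'a feedback" where "S t xs us = \<mu> (xs, map2 (-) (tl xs) us)" for t xs us
  show ?thesis
  proof (intro exI[of _ S] allI impI)
    fix j x0 and f :: "'a \<Rightarrow> 'a" and w :: "nat \<Rightarrow> 'a"
    assume *: "gL_norm f < ereal (l j) \<and> bounded (w ` {1..})"
    define x where "x = closed_loop_state f S w x0"
    define u where "u = closed_loop_input f S w x0"
    define r where "r i = f (x i) + w (Suc i)" for i
    define q where "q k = (map x [0..<Suc k], map r [0..<k])" for k
    have x_Suc: "x (Suc k) = u k + r k" for k
      unfolding x_def u_def r_def by (simp add: closed_loop_recursion(3))
    have "map2 (-) (tl (map x [0..<Suc k])) (map u [0..<k]) = map r [0..<k]" for k
      by (rule nth_equalityI) (simp_all add: nth_tl x_Suc del: upt_Suc)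
    then have u: "u k = \<mu> (q k)" for k
      using closed_loop_recursion(2)[of f S w x0 k]
      unfolding S_def x_def[symmetric] u_def[symmetric] q_def by simp
    obtain \<alpha> where \<alpha>: "\<alpha> > 0" "\<And>x y. norm (f x - f y) \<le> l j * (norm (x - y) + \<alpha>)"
      using gL_norm_less_imp[of f "l j"] * by metis
    obtain W where W: "\<And>i. norm (w (Suc i)) \<le> W"
      using * unfolding bounded_iff by (metis atLeast_iff image_eqI le_add2 plus_1_eq_Suc add.commute)
    have "0 \<le> W" using W[of 0] norm_ge_zero order_trans by blast
    \<comment> \<open>The additive error of \<open>f\<close> plus the disturbances of two
      responses.\<close>
    define M where "M = \<bar>l j * \<alpha>\<bar> + 2 * W"
    have "norm (r i - r i') \<le> l j * norm (x i - x i') + M" for i i'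
    proof -
      have "norm (r i - r i') \<le> norm (f (x i) - f (x i')) + norm (w (Suc i) - w (Suc i'))"
        unfolding r_def using norm_triangle_ineq[of "f (x i) - f (x i')" "w (Suc i) - w (Suc i')"]
        by (simp add: algebra_simps)
      moreover have "norm (w (Suc i) - w (Suc i')) \<le> W + W"
        using norm_triangle_ineq4[of "w (Suc i)" "w (Suc i')"] W[of i] W[of i'] by linarith
      ultimately show ?thesis using \<alpha>(2)[of "x i" "x i'"] unfolding M_def by (simp add: algebra_simps)
    qed
    moreover have "0 \<le> M" using \<open>0 \<le> W\<close> by (simp add: M_def)
    ultimately have "Env (l j) (q k) \<le> M" for k
      unfolding q_def by (subst Env_le_iff) (auto simp: nth_append)
    then have "\<exists>B. \<forall>k. rad (q k) \<le> B"
      by (intro \<mu>[of q j M]) (auto simp: q_def successor_def is_history_def x_Suc u[unfolded q_def])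
    then obtain B where B: "\<And>k. rad (q k) \<le> B" by blast
    have "norm (x k - x 0) \<le> B" for k
      using B[of k] unfolding q_def rad_le_iff by (auto simp del: upt_Suc)
    then have "norm (x k) \<le> B + norm (x 0)" for k
      using norm_triangle_sub[of "x k" "x 0"] by (smt (verit))
    then show "bounded (range (closed_loop_state f S w x0))"
      unfolding x_def[symmetric] bounded_iff by blast
  qed
qed

text \<open>The law is first played against the adversary's strategy; plant and disturbance are
  built afterwards from the recorded responses.\<close>

lemma destabilizing_plant:
  fixes S :: "'a::euclidean_space feedback" and H :: "'a history"
  assumes "H \<in> winning_histories l" "0 \<le> l" "l < L"
  shows "\<exists>f w. gL_norm f < ereal L \<and> bounded (w ` {1..}) \<and>
    \<not> bounded (range (closed_loop_state f S w x0))"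
proof -
  obtain hx hr where H: "H = (hx, hr)" by fastforce
  define n where "n = length hr"
  have len: "length hx = Suc n" and wins: "adversary_wins l H"
    using assms(1) by (auto simp: winning_histories_def is_history_def H n_def)
  then obtain \<sigma> where \<sigma>: "\<And>\<mu>. resulting_play H \<mu> \<sigma> \<in> Esc l H"
    unfolding adversary_wins_def by blast
  txt \<open>The shadow play continues \<open>H\<close>; its states and responses, shifted by \<open>c\<close>, are those of the
    real system started in \<open>x0\<close>. The shift changes neither envelope nor inputs.\<close>
  define c where "c = x0 - last hx"
  \<comment> \<open>Dropping \<open>n\<close> states leaves a list that starts with
    \<open>last hx\<close>, which the shift moves to \<open>x0\<close>; so \<open>S\<close> sees its
    own time 0. Its past inputs are recovered as next state minus response.\<close>
  define \<mu> :: "'a controller" where "\<mu> = (\<lambda>(xs, rs). S (length rs - n)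
      (map (\<lambda>x. x + c) (drop n xs)) (map2 (-) (drop (Suc n) xs) (drop n rs)))"
  define q where "q = hist_seq H \<mu> \<sigma>"
  define v where "v k = \<mu> (q k)" for k
  define r where "r k = \<sigma> (q k) (v k)" for k
  define y where "y k = (case k of 0 \<Rightarrow> last hx | Suc k \<Rightarrow> v k + r k)" for k
  have q_eq: "q k = (butlast hx @ map y [0..<Suc k], hr @ map r [0..<k])" for k
  proof (induction k)
    case 0
    have "hx \<noteq> []" using len by auto
    then show ?case by (simp add: q_def H y_def)
  next
    case (Suc k)
    have "q (Suc k) = successor (q k) (v k) (r k)"
      by (simp add: q_def v_def r_def Let_def)
    then show ?case using Suc by (simp add: successor_def y_def)
  qed
  have "map2 (-) (map y [Suc 0..<Suc k]) (map r [0..<k]) = map v [0..<k]" for k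
    by (rule nth_equalityI) (simp_all add: y_def del: upt_Suc)
  then have v: "v k = S k (map (\<lambda>i. y i + c) [0..<Suc k]) (map v [0..<k])" for k
    unfolding v_def[of k] q_eq \<mu>_def using len
    by (simp add: n_def drop_map comp_def del: upt_Suc)
  obtain M where M: "\<And>k. Env l (q k) \<le> M" and rad: "\<nexists>B. \<forall>k. rad (q k) \<le> B"
    using \<sigma>[of \<mu>] unfolding resulting_play_Esc_iff q_def by blast
  have r: "norm (r i - r j) \<le> l * norm (y i - y j) + max M 0" for i j
  proof -
    define k where "k = Suc (max i j)"
    have "Env l (q k) \<le> max M 0" using M[of k] by simp
    then have *: "i' < length (hr @ map r [0..<k]) \<Longrightarrow> j' < length (hr @ map r [0..<k]) \<Longrightarrow>
        norm ((hr @ map r [0..<k]) ! i' - (hr @ map r [0..<k]) ! j') \<le> l * norm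
          ((butlast hx @ map y [0..<Suc k]) ! i' - (butlast hx @ map y [0..<Suc k]) ! j') + max M 0" for i' j'
      unfolding q_eq Env_le_iff[OF max.cobounded2] by blast
    have "i < k" "j < k" by (auto simp: k_def)
    then show ?thesis using *[of "n + i" "n + j"] len by (simp add: nth_append n_def del: upt_Suc)
  qed
  \<comment> \<open>Shifting responses as well as states by \<open>c\<close> leaves the inputs
    \<open>y (Suc i) - r i\<close> unchanged.\<close>
  define D where "D = range (\<lambda>i. (y i + c, r i + c))"
  have "norm (snd p - snd p') \<le> l * norm (fst p - fst p') + max M 0" if "p \<in> D" "p' \<in> D" for p p'
    using that r unfolding D_def by auto
  \<comment> \<open>The intermediate constant makes the final inequality for
    \<open>gL_norm f\<close> strict.\<close>
  moreover obtain L' where L': "l < L'" "L' < L" using dense[OF assms(3)] by blast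
  ultimately obtain f B where f: "\<And>x y. norm (f x - f y) \<le> L' * norm (x - y)"
    and B: "\<And>p. p \<in> D \<Longrightarrow> norm (f (fst p) - snd p) \<le> B"
    using coarse_lipschitz_extension[OF _ assms(2)] by metis
  define w where "w t = r (t - 1) + c - f (y (t - 1) + c)" for t
  have "gL_norm f \<le> ereal L'"
    using L' assms(2) by (intro gL_norm_le_lipschitz f) simp
  then have "gL_norm f < ereal L" using L' by (meson ereal_less(2) le_less_trans less_ereal.simps(1))
  moreover have "norm (w t) \<le> B" for t
    using B[of "(y (t - 1) + c, r (t - 1) + c)"] unfolding w_def D_def by (simp add: norm_minus_commute)
  then have "bounded (w ` {1..})" unfolding bounded_iff by blast
  moreover have "\<not> bounded (range (closed_loop_state f S w x0))"
  proof
    have "closed_loop f S w x0 t = (map (\<lambda>i. y i + c) [0..<Suc t], map v [0..<t])" for t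
    proof (induction t)
      case 0
      show ?case by (simp add: y_def c_def)
    next
      case (Suc t)
      show ?case unfolding closed_loop.simps Suc Let_def case_prod_conv v[symmetric]
        by (simp add: w_def y_def)
    qed
    then have "closed_loop_state f S w x0 = (\<lambda>t. y t + c)"
      by (auto simp: closed_loop_state_def)
    moreover assume "bounded (range (closed_loop_state f S w x0))"
    ultimately have "bounded ((\<lambda>x. - c + x) ` range (\<lambda>t. y t + c))"
      by (intro bounded_translation) simp
    then have "bounded (range y)" by (simp add: image_image)
    \<comment> \<open>The radius of \<open>q k\<close> also involves the finitely many states of
      \<open>H\<close>.\<close>
    then have "bounded (set hx \<union> range y)" by (simp add: finite_imp_bounded)
    then obtain K where K: "\<And>x. x \<in> set hx \<union> range y \<Longrightarrow> norm x \<le> K"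
      unfolding bounded_iff by blast
    have "rad (q k) \<le> K + K" for k
      unfolding q_eq rad_le_iff
    proof (intro allI impI)
      fix i assume i: "i \<le> length (hr @ map r [0..<k])"
      let ?xs = "butlast hx @ map y [0..<Suc k]"
      have K_xs: "norm x \<le> K" if "x \<in> set ?xs" for x
        by (rule K) (use that in \<open>auto dest: in_set_butlastD\<close>)
      have "i < length ?xs" "0 < length ?xs"
        using i len by (simp_all add: n_def)
      from this[THEN nth_mem, THEN K_xs] show "norm (?xs ! i - ?xs ! 0) \<le> K + K"
        using norm_triangle_ineq4[of "?xs ! i" "?xs ! 0"] by linarith
    qed
    then show False using rad by blast
  qed
  ultimately show ?thesis by blast
qed

theorem theorem3p7:
  shows "(\<exists>S :: (real ^ 'd) feedback.
           \<forall>L x0 f w. 0 \<le> L \<and> ereal L < game_value TYPE(real ^ 'd) \<and>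
             f \<in> plants L \<and> bounded (w ` {1..}) \<longrightarrow>
             bounded (range (closed_loop_state f S w x0)))
       \<and> (\<forall>L. game_value TYPE(real ^ 'd) < ereal L \<longrightarrow>
           (\<forall>(S :: (real ^ 'd) feedback) x0. \<exists>f w.
              gL_norm f < ereal L \<and> bounded (w ` {1..}) \<and>
              \<not> bounded (range (closed_loop_state f S w x0))))"
proof (intro conjI allI impI)
  define A where "A = {ereal l |l. 0 \<le> l \<and> winning_histories l = ({} :: (real ^ 'd) history set)}"
  have game_value_eq: "game_value TYPE(real ^ 'd) = Sup ({0} \<union> A)"
    unfolding game_value_def A_def ..
  show "\<exists>S :: (real ^ 'd) feedback.
      \<forall>L x0 f w. 0 \<le> L \<and> ereal L < game_value TYPE(real ^ 'd) \<and>
        f \<in> plants L \<and> bounded (w ` {1..}) \<longrightarrow>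
        bounded (range (closed_loop_state f S w x0))"
  proof (cases "A = {}")
    case True
    then show ?thesis unfolding game_value_eq by auto
  next
    case False
    \<comment> \<open>Countably many levels with supremum \<open>Sup A\<close> suffice, which is
      what lets one law serve every \<open>L\<close>.\<close>
    then obtain g :: "nat \<Rightarrow> ereal" where g: "range g \<subseteq> A" "Sup A = (SUP j. g j)"
      using Sup_countable_SUP by blast
    have "\<exists>a. g j = ereal a \<and> winning_histories a = ({} :: (real ^ 'd) history set)" for j
      using g(1) unfolding A_def by blast
    then obtain l where l: "\<And>j. g j = ereal (l j)"
        "\<And>j. winning_histories (l j) = ({} :: (real ^ 'd) history set)"
      by metis
    obtain S :: "(real ^ 'd) feedback" where S:
      "\<And>j x0 f w. gL_norm f < ereal (l j) \<Longrightarrow> bounded (w ` {1..}) \<Longrightarrow>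
        bounded (range (closed_loop_state f S w x0))"
      using stabilizing_feedback[of l, OF l(2)] by metis
    show ?thesis
    proof (intro exI[of _ S] allI impI)
      fix L x0 and f :: "real ^ 'd \<Rightarrow> real ^ 'd" and w :: "nat \<Rightarrow> real ^ 'd"
      assume *: "0 \<le> L \<and> ereal L < game_value TYPE(real ^ 'd) \<and> f \<in> plants L \<and> bounded (w ` {1..})"
      then obtain a where a: "a \<in> {0} \<union> A" "ereal L < a"
        unfolding game_value_eq less_Sup_iff by blast
      moreover have "a \<noteq> 0" using * a(2) by auto
      ultimately have "ereal L < Sup A" unfolding less_Sup_iff by blast
      then obtain j where "ereal L < ereal (l j)" unfolding g(2) less_SUP_iff l(1) by blast
      moreover have "gL_norm f \<le> ereal L" using * by (simp add: plants_def)
      ultimately show "bounded (range (closed_loop_state f S w x0))"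
        using * by (intro S[of f j]) (blast intro: le_less_trans, blast)
    qed
  qed
  fix L and S :: "(real ^ 'd) feedback" and x0
  assume "game_value TYPE(real ^ 'd) < ereal L"
  \<comment> \<open>A level strictly above the supremum cannot belong to \<open>A\<close>, so the
    adversary wins there from some history.\<close>
  then obtain l where l: "game_value TYPE(real ^ 'd) < ereal l" "l < L"
    using ereal_dense2 by fastforce
  have "0 \<le> game_value TYPE(real ^ 'd)" unfolding game_value_eq by (simp add: Sup_upper)
  then have "0 \<le> l" using l(1) by (metis ereal_less_eq(5) less_imp_le order_trans)
  moreover have "ereal l \<notin> A"
  proof
    assume "ereal l \<in> A"
    then have "ereal l \<le> game_value TYPE(real ^ 'd)"
      unfolding game_value_eq by (intro Sup_upper) simp
    with l(1) show False by (meson leD)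
  qed
  ultimately obtain H :: "(real ^ 'd) history" where "H \<in> winning_histories l"
    unfolding A_def by blast
  then show "\<exists>f w. gL_norm f < ereal L \<and> bounded (w ` {1..}) \<and>
      \<not> bounded (range (closed_loop_state f S w x0))"
    using \<open>0 \<le> l\<close> l(2) by (rule destabilizing_plant)
qed

end
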